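(* Let $P$ be a bounded and graded poset. Then \[\underline{H}_P(t)=1+t\sum_{x\in P,\ 2\le\rho(x)\le\rho(P)-1}\underline{H}_{[x,\widehat1]}(t)+t\,\underline{H}_{\sigma(P)}(t).\] Alternatively, \[\underline{H}_P(t)=(t+1)\,\underline{H}_{\sigma(P)}(t)-t\,\underline{H}_{\sigma^2(P)}(t)+t\sum_{x\in P,\ \rho(x)=2}\underline{H}_{[x,\widehat1]}(t).\]
   Context: All posets are finite, bounded (least element $\widehat 0$, greatest element $\widehat 1$) and graded with rank function $\rho$, $\rho(\widehat 0)=0$; $\rho(P):=\rho(\widehat1)$. The dual truncation $\sigma(Q)$ of a bounded graded poset $Q$ is $Q$ with all its atoms (elements of rank $1$) removed. $[x,\widehat1]$ denotes an interval of $P$. Chow polynomial: with $\mu$ the Möbius function, $\chi_{[x,y]}(t)=\sum_{x\le z\le y}\mu(x,z)t^{\rho(y)-\rho(z)}$; $\overline{\chi}_{[x,x]}=-1$ and $\overline{\chi}_{[x,y]}=\chi_{[x,y]}/(t-1)$ for $x<y$; $\underline{H}_{[x,x]}=1$ and $\underline{H}_{[x,y]}=\sum_{x<z\le y}\overline{\chi}_{[x,z]}\underline{H}_{[z,y]}$ for $x<y$ (ranks taken in the respective interval/poset); $\underline{H}_Q:=\underline{H}_{[\widehat0,\widehat1]}$ computed in $Q$.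
   Formalization: The first identity is stated only for $\rho(P)\ge 2$: for $\rho(P)\le 1$ both $\underline{H}_P$ and $\underline{H}_{\sigma(P)}$ equal 1 and the sum is empty, so it would read $1=1+t$; the second identity is stated for every rank. *)

theory Defs
  imports "HOL-Computational_Algebra.Polynomial"
begin

text \<open>
  A poset is represented by its (reflexive) order relation \<open>r\<close>: its set of elements is
  \<open>Field r\<close>, and \<open>(x, y) \<in> r\<close> means \<open>x \<le> y\<close>. A subposet on \<open>A\<close> is \<open>Restr r A\<close>.
\<close>

definition finite_poset :: "'a rel \<Rightarrow> bool" where
  "finite_poset r \<longleftrightarrow> finite (Field r) \<and> Partial_order r"

definition is_least :: "'a rel \<Rightarrow> 'a \<Rightarrow> bool" where
  "is_least r b \<longleftrightarrow> b \<in> Field r \<and> (\<forall>x\<in>Field r. (b, x) \<in> r)"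

definition is_greatest :: "'a rel \<Rightarrow> 'a \<Rightarrow> bool" where
  "is_greatest r b \<longleftrightarrow> b \<in> Field r \<and> (\<forall>x\<in>Field r. (x, b) \<in> r)"

definition bounded_poset :: "'a rel \<Rightarrow> bool" where
  "bounded_poset r \<longleftrightarrow> finite_poset r \<and> (\<exists>b. is_least r b) \<and> (\<exists>b. is_greatest r b)"

definition poset_bot :: "'a rel \<Rightarrow> 'a" where
  "poset_bot r = (THE b. is_least r b)"

definition poset_top :: "'a rel \<Rightarrow> 'a" where
  "poset_top r = (THE b. is_greatest r b)"

definition covers :: "'a rel \<Rightarrow> 'a \<Rightarrow> 'a \<Rightarrow> bool" where
  "covers r x y \<longleftrightarrow> (x, y) \<in> r \<and> x \<noteq> y \<and>
     (\<forall>z. (x, z) \<in> r \<longrightarrow> (z, y) \<in> r \<longrightarrow> z = x \<or> z = y)"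

definition rank_function :: "'a rel \<Rightarrow> ('a \<Rightarrow> nat) \<Rightarrow> bool" where
  "rank_function r \<rho> \<longleftrightarrow>
     \<rho> (poset_bot r) = 0 \<and> (\<forall>x y. covers r x y \<longrightarrow> \<rho> y = Suc (\<rho> x))"

definition bounded_graded_poset :: "'a rel \<Rightarrow> bool" where
  "bounded_graded_poset r \<longleftrightarrow> bounded_poset r \<and> (\<exists>\<rho>. rank_function r \<rho>)"

text \<open>
  On \<open>Field r\<close> the value below does not depend on the choice of the rank function,
  see \<open>rank_function_unique\<close>.
\<close>

definition rk :: "'a rel \<Rightarrow> 'a \<Rightarrow> nat" where
  "rk r = (SOME \<rho>. rank_function r \<rho>)"

definition poset_rank :: "'a rel \<Rightarrow> nat" where
  "poset_rank r = rk r (poset_top r)"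

text \<open>
  If \<open>r\<close> has rank \<open>1\<close>, its top element is its only atom, and the dual truncation is the
  one-element poset; the one-element poset is its own dual truncation.
\<close>

definition dual_truncation :: "'a rel \<Rightarrow> 'a rel" where
  "dual_truncation r = Restr r {x \<in> Field r. rk r x \<noteq> 1}"

definition interval :: "'a rel \<Rightarrow> 'a \<Rightarrow> 'a \<Rightarrow> 'a set" where
  "interval r x y = {z. (x, z) \<in> r \<and> (z, y) \<in> r}"

lemma finite_interval: "finite_poset r \<Longrightarrow> finite (interval r x y)"
  by (rule finite_subset[of _ "Field r"]) (auto simp: finite_poset_def interval_def Field_def)

lemma card_interval_less_left:
  assumes "finite_poset r" "(x, y) \<in> r" "z \<in> interval r x y - {y}"
  shows "card (interval r x z) < card (interval r x y)"
proof (rule psubset_card_mono)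
  show "finite (interval r x y)" using assms(1) by (rule finite_interval)
  have "trans r" "antisym r" and "y \<in> interval r x y"
    using assms by (auto simp: finite_poset_def order_on_defs interval_def refl_on_def Field_def)
  then show "interval r x z \<subset> interval r x y"
    using assms(3) by (auto simp: interval_def dest: transD antisymD)
qed

lemma card_interval_less_right:
  assumes "finite_poset r" "(x, y) \<in> r" "z \<in> interval r x y - {x}"
  shows "card (interval r z y) < card (interval r x y)"
proof (rule psubset_card_mono)
  show "finite (interval r x y)" using assms(1) by (rule finite_interval)
  have "trans r" "antisym r" and "x \<in> interval r x y"
    using assms by (auto simp: finite_poset_def order_on_defs interval_def refl_on_def Field_def)
  then show "interval r z y \<subset> interval r x y"
    using assms(3) by (auto simp: interval_def dest: transD antisymD)
qed

text \<open>
  The guard \<open>finite_poset r \<and> (x, y) \<in> r\<close> in the two recursive definitions below only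
  serves termination; outside of it the value \<open>0\<close> is a dummy.
\<close>

function moebius :: "'a rel \<Rightarrow> 'a \<Rightarrow> 'a \<Rightarrow> int" where
  "moebius r x y =
     (if finite_poset r \<and> (x, y) \<in> r
      then if x = y then 1 else - (\<Sum>z\<in>interval r x y - {y}. moebius r x z)
      else 0)"
  by auto
termination
  by (relation "measure (\<lambda>(r, x, y). card (interval r x y))")
     (auto intro: card_interval_less_left)

definition char_poly :: "'a rel \<Rightarrow> 'a \<Rightarrow> 'a \<Rightarrow> int poly" where
  "char_poly r x y = (\<Sum>z\<in>interval r x y. monom (moebius r x z) (rk r y - rk r z))"

text \<open>The division by \<open>t - 1\<close> is exact, see \<open>char_poly_dvd\<close>.\<close>

definition reduced_char_poly :: "'a rel \<Rightarrow> 'a \<Rightarrow> 'a \<Rightarrow> int poly" where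
  "reduced_char_poly r x y = (if x = y then -1 else char_poly r x y div [:-1, 1:])"

function chow_interval :: "'a rel \<Rightarrow> 'a \<Rightarrow> 'a \<Rightarrow> int poly" where
  "chow_interval r x y =
     (if finite_poset r \<and> (x, y) \<in> r
      then if x = y then 1
           else \<Sum>z\<in>interval r x y - {x}. reduced_char_poly r x z * chow_interval r z y
      else 0)"
  by auto
termination
  by (relation "measure (\<lambda>(r, x, y). card (interval r x y))")
     (auto intro: card_interval_less_right)

declare moebius.simps [simp del] chow_interval.simps [simp del]

definition chow_polynomial :: "'a rel \<Rightarrow> int poly" where
  "chow_polynomial r = chow_interval r (poset_bot r) (poset_top r)"

lemma char_poly_dvd:
  assumes "finite_poset r" "(x, y) \<in> r" "x \<noteq> y"
  shows "[:-1, 1:] dvd char_poly r x y"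
proof -
  have "y \<in> interval r x y"
    using assms by (auto simp: finite_poset_def order_on_defs interval_def refl_on_def Field_def)
  then have "poly (char_poly r x y) 1 = moebius r x y + (\<Sum>z\<in>interval r x y - {y}. moebius r x z)"
    by (simp add: char_poly_def poly_sum poly_monom sum.remove finite_interval assms(1))
  also have "\<dots> = 0"
    using assms by (simp add: moebius.simps[of r x y])
  finally show ?thesis
    by (simp add: poly_eq_0_iff_dvd)
qed

lemma is_least_poset_bot:
  assumes "bounded_poset r"
  shows "is_least r (poset_bot r)"
proof -
  have "antisym r"
    using assms by (simp add: bounded_poset_def finite_poset_def order_on_defs)
  then have "\<exists>!b. is_least r b"
    using assms unfolding bounded_poset_def is_least_def antisym_def by blast
  then show ?thesis
    unfolding poset_bot_def by (rule theI')
qed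

lemma rank_function_unique:
  assumes P: "bounded_poset r" and \<rho>: "rank_function r \<rho>" and \<rho>': "rank_function r \<rho>'"
    and "x \<in> Field r"
  shows "\<rho> x = \<rho>' x"
  using \<open>x \<in> Field r\<close>
proof (induction "card (interval r (poset_bot r) x)" arbitrary: x rule: less_induct)
  case less
  define b where "b = poset_bot r"
  have fp: "finite_poset r"
    using P by (simp add: bounded_poset_def)
  then have tr: "trans r" and an: "antisym r" and rf: "\<And>y. y \<in> Field r \<Longrightarrow> (y, y) \<in> r"
    by (auto simp: finite_poset_def order_on_defs refl_on_def)
  have b: "(b, y) \<in> r" if "y \<in> Field r" for y
    using is_least_poset_bot[OF P] that by (simp add: is_least_def b_def)
  show ?case
  proof (cases "x = b")
    case True
    then show ?thesis
      using \<rho> \<rho>' by (simp add: rank_function_def b_def)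
  next
    case False
    let ?S = "interval r b x - {x}"
    let ?c = "\<lambda>y. card (interval r b y)"
    have "b \<in> ?S"
      using False b[OF less.prems] rf[of b] by (auto simp: interval_def Field_def)
    moreover have fin: "finite ?S"
      using finite_interval[OF fp] by blast
    ultimately obtain y where y: "y \<in> ?S" and ymax: "\<And>z. z \<in> ?S \<Longrightarrow> ?c z \<le> ?c y"
      using Max_in[of "?c ` ?S"] Max_ge[of "?c ` ?S"] by fastforce
    have "covers r y x"
      unfolding covers_def
    proof (intro conjI allI impI)
      show "(y, x) \<in> r" "y \<noteq> x" using y by (auto simp: interval_def)
      fix z assume z: "(y, z) \<in> r" "(z, x) \<in> r"
      show "z = y \<or> z = x"
      proof (rule ccontr)
        assume "\<not> (z = y \<or> z = x)"
        moreover have bz: "(b, z) \<in> r"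
          using y z tr by (auto simp: interval_def dest: transD)
        ultimately have "z \<in> ?S" and "y \<in> interval r b z - {z}"
          using y z by (auto simp: interval_def)
        then show False
          using card_interval_less_left[OF fp bz, of y] ymax[of z] by simp
      qed
    qed
    moreover have "\<rho> y = \<rho>' y"
    proof (rule less.hyps)
      show "y \<in> Field r" using y by (auto simp: interval_def Field_def)
      show "card (interval r (poset_bot r) y) < card (interval r (poset_bot r) x)"
        using card_interval_less_left[OF fp b[OF less.prems] y] by (simp add: b_def)
    qed
    ultimately show ?thesis
      using \<rho> \<rho>' by (simp add: rank_function_def)
  qed
qed

end

theory Submission
  imports Defs
begin

text \<open>
  Write \<open>H x\<close> for the Chow polynomial of \<open>[x, y]\<close> with \<open>y\<close> fixed. Multiplying its defining
  recursion by \<open>t - 1\<close> and inverting the Moebius function turns it into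
  \<open>H x = 1 + (\<Sum>z>x. a (\<rho> z - \<rho> x) * H z)\<close> with \<open>a n = t + \<dots> + t ^ (n - 1)\<close>.
  Passing from \<open>P\<close> to its dual truncation lowers all positive ranks by one and does not change
  the intervals above elements of rank at least two, so both identities reduce to
  \<open>a (n + 1) = t + t * a n\<close> for \<open>n \<ge> 1\<close>.
\<close>

section \<open>Intervals and covers in finite posets\<close>

lemma finite_poset_trans: "finite_poset r \<Longrightarrow> (x, y) \<in> r \<Longrightarrow> (y, z) \<in> r \<Longrightarrow> (x, z) \<in> r"
  by (auto simp: finite_poset_def order_on_defs dest: transD)

lemma finite_poset_antisym: "finite_poset r \<Longrightarrow> (x, y) \<in> r \<Longrightarrow> (y, x) \<in> r \<Longrightarrow> x = y"
  by (auto simp: finite_poset_def order_on_defs dest: antisymD)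

lemma finite_poset_refl: "finite_poset r \<Longrightarrow> x \<in> Field r \<Longrightarrow> (x, x) \<in> r"
  by (auto simp: finite_poset_def order_on_defs refl_on_def)

lemma interval_endpoints:
  assumes "finite_poset r" "(x, y) \<in> r"
  shows "x \<in> interval r x y" "y \<in> interval r x y"
  using assms finite_poset_refl[of r x] finite_poset_refl[of r y]
  by (auto simp: interval_def Field_def)

lemma interval_self:
  assumes "finite_poset r" "x \<in> Field r"
  shows "interval r x x = {x}"
  using assms finite_poset_refl[of r x] finite_poset_antisym[of r] by (auto simp: interval_def)

text \<open>Both sides run over the pairs with \<open>x \<le> w \<le> z \<le> y\<close>; this is
  what makes convolution in the incidence algebra associative.\<close>

lemma sum_interval_swap:
  assumes "finite_poset r"
  shows "(\<Sum>z\<in>interval r x y. \<Sum>w\<in>interval r x z. f w z) =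
         (\<Sum>w\<in>interval r x y. \<Sum>z\<in>interval r w y. f w z)"
proof -
  have "(\<Sum>z\<in>interval r x y. \<Sum>w\<in>interval r x z. f w z) =
        (\<Sum>z\<in>interval r x y. \<Sum>w\<in>{w \<in> interval r x y. (w, z) \<in> r}. f w z)"
    by (intro sum.cong) (auto simp: interval_def intro: finite_poset_trans[OF assms])
  also have "\<dots> = (\<Sum>w\<in>interval r x y. \<Sum>z\<in>{z \<in> interval r x y. (w, z) \<in> r}. f w z)"
    by (rule sum.swap_restrict) (simp_all add: finite_interval assms)
  also have "\<dots> = (\<Sum>w\<in>interval r x y. \<Sum>z\<in>interval r w y. f w z)"
    by (intro sum.cong) (auto simp: interval_def intro: finite_poset_trans[OF assms])
  finally show ?thesis .
qed

text \<open>Replacing \<open>x\<close> by an element strictly between \<open>x\<close> and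
  \<open>y\<close> shrinks the interval, so the process stops at a cover. Rank functions are
  constrained on covers only; this extends the control to all comparable pairs.\<close>

lemma ex_lower_cover:
  assumes "finite_poset r" "(x, y) \<in> r" "x \<noteq> y"
  shows "\<exists>w. (x, w) \<in> r \<and> covers r w y"
  using assms(2,3)
proof (induction "card (interval r x y)" arbitrary: x rule: less_induct)
  case less
  show ?case
  proof (cases "covers r x y")
    case True
    then show ?thesis
      using interval_endpoints(1)[OF assms(1) less.prems(1)] by (auto simp: interval_def)
  next
    case False
    then obtain z where z: "(x, z) \<in> r" "(z, y) \<in> r" "z \<noteq> x" "z \<noteq> y"
      using less.prems by (auto simp: covers_def)
    then have "card (interval r z y) < card (interval r x y)"
      using card_interval_less_right[OF assms(1) less.prems(1), of z] by (simp add: interval_def)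
    then obtain w where "(z, w) \<in> r" "covers r w y"
      using less.hyps z by blast
    then show ?thesis
      using z(1) finite_poset_trans[OF assms(1)] by blast
  qed
qed

section \<open>Ranks, least and greatest elements\<close>

lemma rank_function_rk: "bounded_graded_poset r \<Longrightarrow> rank_function r (rk r)"
  unfolding bounded_graded_poset_def rk_def by (metis someI_ex)

lemma bounded_graded_poset_imp_finite: "bounded_graded_poset r \<Longrightarrow> finite_poset r"
  by (simp add: bounded_graded_poset_def bounded_poset_def)

text \<open>As \<open>rk\<close> is an arbitrary choice, its values are computed by exhibiting some
  rank function. The ranks of the dual truncation are found in this way.\<close>

lemma rk_eq:
  assumes "bounded_poset r" "rank_function r \<rho>" "x \<in> Field r"
  shows "rk r x = \<rho> x"
  using rank_function_unique[OF assms(1) rank_function_rk assms(2,3)] assms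
  by (auto simp: bounded_graded_poset_def)

lemma rk_strict_mono:
  assumes P: "bounded_graded_poset r" and "(x, y) \<in> r" "x \<noteq> y"
  shows "rk r x < rk r y"
  using assms(2,3)
proof (induction "card (interval r x y)" arbitrary: y rule: less_induct)
  case less
  note fp = bounded_graded_poset_imp_finite[OF P]
  obtain w where w: "(x, w) \<in> r" "covers r w y"
    using ex_lower_cover[OF fp less.prems] by blast
  have *: "rk r y = Suc (rk r w)"
    using rank_function_rk[OF P] w by (simp add: rank_function_def)
  have "card (interval r x w) < card (interval r x y)"
    using card_interval_less_left[OF fp less.prems(1), of w] w
    by (auto simp: interval_def covers_def)
  then show ?case
    using less.hyps[of w] w * by (cases "x = w") auto
qed

lemma is_greatest_poset_top:
  assumes "bounded_poset r"
  shows "is_greatest r (poset_top r)"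
proof -
  have "\<exists>!b. is_greatest r b"
    using assms finite_poset_antisym[of r] unfolding bounded_poset_def is_greatest_def by blast
  then show ?thesis
    unfolding poset_top_def by (rule theI')
qed

lemma poset_bot_eq:
  assumes "bounded_poset r" "is_least r b"
  shows "poset_bot r = b"
  using is_least_poset_bot[OF assms(1)] assms finite_poset_antisym[of r]
  unfolding bounded_poset_def is_least_def by blast

lemma poset_top_eq:
  assumes "bounded_poset r" "is_greatest r b"
  shows "poset_top r = b"
  using is_greatest_poset_top[OF assms(1)] assms finite_poset_antisym[of r]
  unfolding bounded_poset_def is_greatest_def by blast

section \<open>Moebius inversion of the defining recursion\<close>

lemma sum_moebius_interval:
  assumes "finite_poset r" "(x, y) \<in> r"
  shows "(\<Sum>z\<in>interval r x y. moebius r x z) = (if x = y then 1 else 0)"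
proof (cases "x = y")
  case True
  have "y \<in> Field r" using assms by (auto simp: Field_def)
  then show ?thesis
    using True assms by (simp add: interval_self moebius.simps[of r y y])
next
  case False
  then show ?thesis
    using assms
    by (simp add: sum.remove[OF finite_interval interval_endpoints(2)] moebius.simps[of r x y])
qed

text \<open>The Moebius function is unitriangular, hence injective under convolution: by induction
  only the term \<open>w = x\<close> survives, and its coefficient is 1.\<close>

lemma moebius_sum_eq_0_imp_eq_0:
  fixes D :: "'a \<Rightarrow> int poly"
  assumes fp: "finite_poset r" and xy: "(x, y) \<in> r"
    and D: "\<And>x. (x, y) \<in> r \<Longrightarrow> (\<Sum>w\<in>interval r x y. of_int (moebius r x w) * D w) = 0"
  shows "D x = 0"
  using xy
proof (induction "card (interval r x y)" arbitrary: x rule: less_induct)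
  case less
  have "D w = 0" if "w \<in> interval r x y - {x}" for w
    using less.hyps[of w] card_interval_less_right[OF fp less.prems that] that
    by (auto simp: interval_def)
  then have "(\<Sum>w\<in>interval r x y. of_int (moebius r x w) * D w) = of_int (moebius r x x) * D x"
    by (simp add: sum.remove[OF finite_interval interval_endpoints(1)] fp less.prems)
  moreover have "moebius r x x = 1"
    using interval_endpoints(1)[OF fp less.prems] fp
    by (simp add: moebius.simps[of r x x] interval_def)
  ultimately show ?case
    using D[OF less.prems] by simp
qed

lemma monom_eq_of_int_mult: "monom (c :: int) n = of_int c * [:0, 1:] ^ n"
  by (simp add: of_int_poly monom_altdef)

lemma char_poly_self:
  assumes "finite_poset r" "x \<in> Field r"
  shows "char_poly r x x = 1"
  using assms finite_poset_refl[OF assms]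
  by (simp add: char_poly_def interval_self moebius.simps[of r x x])

text \<open>For \<open>x \<noteq> y\<close>, the terms above \<open>x\<close> give
  \<open>(t - 1) * H x\<close> by the defining recursion, and the term \<open>z = x\<close> adds
  \<open>H x\<close>. For \<open>x = y\<close> the sum is 1, written as
  \<open>t - (t - 1)\<close>.\<close>

lemma sum_char_poly_chow:
  assumes fp: "finite_poset r" and xy: "(x, y) \<in> r"
  shows "(\<Sum>z\<in>interval r x y. char_poly r x z * chow_interval r z y) =
         [:0, 1:] * chow_interval r x y - (if x = y then [:-1, 1:] else 0)"
proof (cases "x = y")
  case True
  have "y \<in> Field r" using xy by (auto simp: Field_def)
  then show ?thesis
    using True xy by (simp add: interval_self fp char_poly_self chow_interval.simps[of r y y] one_pCons)
next
  case False
  have "x \<in> Field r" using xy by (auto simp: Field_def)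
  have "[:-1, 1:] * reduced_char_poly r x z = char_poly r x z" if "z \<in> interval r x y - {x}" for z
    using char_poly_dvd[OF fp, of x z] that
    by (auto simp: reduced_char_poly_def interval_def simp del: mult_pCons_left)
  then have "(\<Sum>z\<in>interval r x y - {x}. char_poly r x z * chow_interval r z y) =
      [:-1, 1:] * (\<Sum>z\<in>interval r x y - {x}. reduced_char_poly r x z * chow_interval r z y)"
    unfolding sum_distrib_left by (intro sum.cong) (simp_all flip: mult.assoc del: mult_pCons_left)
  also have "\<dots> = [:-1, 1:] * chow_interval r x y"
    using fp xy False by (simp add: chow_interval.simps[of r x y] del: mult_pCons_left)
  finally have "(\<Sum>z\<in>interval r x y. char_poly r x z * chow_interval r z y) =
      chow_interval r x y + [:-1, 1:] * chow_interval r x y"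
    by (simp add: sum.remove[OF finite_interval interval_endpoints(1)] fp xy
        char_poly_self \<open>x \<in> Field r\<close> del: mult_pCons_left)
  also have "\<dots> = [:0, 1:] * chow_interval r x y"
    by simp
  finally show ?thesis using False by simp
qed

text \<open>This is the Moebius inversion of \<open>sum_char_poly_chow\<close>: \<open>D\<close>,
  the difference of the two sides, is annihilated by convolution with the Moebius function, hence
  zero.\<close>

lemma sum_chow_interval_ranks:
  assumes fp: "finite_poset r" and xy: "(x, y) \<in> r"
  shows "(\<Sum>z\<in>interval r x y. ([:0, 1:] - [:0, 1:] ^ (rk r z - rk r x)) * chow_interval r z y) =
         [:-1, 1:]"
proof -
  define t :: "int poly" where "t = [:0, 1:]"
  define H where "H = (\<lambda>z. chow_interval r z y)"
  define D where
    "D = (\<lambda>x. (\<Sum>z\<in>interval r x y. (t - t ^ (rk r z - rk r x)) * H z) - [:-1, 1:])"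
  have "(\<Sum>w\<in>interval r x y. of_int (moebius r x w) * D w) = 0" if x: "(x, y) \<in> r" for x
  proof -
    have "(\<Sum>w\<in>interval r x y. of_int (moebius r x w) * D w) =
      (\<Sum>w\<in>interval r x y. \<Sum>z\<in>interval r w y. t * (of_int (moebius r x w) * H z)) -
      (\<Sum>w\<in>interval r x y. \<Sum>z\<in>interval r w y. of_int (moebius r x w) * t ^ (rk r z - rk r w) * H z) -
      of_int (\<Sum>w\<in>interval r x y. moebius r x w) * [:-1, 1:]"
      unfolding D_def
      by (simp add: sum_distrib_left sum_distrib_right right_diff_distrib left_diff_distrib
          sum_subtractf mult_ac del: mult_pCons_left mult_pCons_right)
    \<comment> \<open>After the swap, the coefficient of \<open>H z\<close> is the sum of
      \<open>moebius r x w * t ^ (rk r z - rk r w)\<close> over \<open>w\<close>, which is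
      \<open>char_poly r x z\<close>.\<close>
    also have "(\<Sum>w\<in>interval r x y. \<Sum>z\<in>interval r w y.
          of_int (moebius r x w) * t ^ (rk r z - rk r w) * H z) =
        (\<Sum>z\<in>interval r x y. char_poly r x z * H z)"
      by (simp add: char_poly_def monom_eq_of_int_mult sum_distrib_right t_def
          flip: sum_interval_swap[OF fp] del: mult_pCons_left mult_pCons_right)
    also have "\<dots> = t * H x - (if x = y then [:-1, 1:] else 0)"
      unfolding H_def t_def by (rule sum_char_poly_chow[OF fp x])
    \<comment> \<open>Without the rank weight, the same swap leaves the Moebius sum over
      \<open>interval r x z\<close>, which vanishes unless \<open>z = x\<close>.\<close>
    also have "(\<Sum>w\<in>interval r x y. \<Sum>z\<in>interval r w y. t * (of_int (moebius r x w) * H z)) =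
        (\<Sum>z\<in>interval r x y. t * of_int (\<Sum>w\<in>interval r x z. moebius r x w) * H z)"
      by (simp add: sum_distrib_left sum_distrib_right mult.assoc flip: sum_interval_swap[OF fp])
    also have "\<dots> = (\<Sum>z\<in>interval r x y. if x = z then t * H x else 0)"
    proof (intro sum.cong refl)
      fix z assume "z \<in> interval r x y"
      then have "(x, z) \<in> r" by (simp add: interval_def)
      from sum_moebius_interval[OF fp this]
      show "t * of_int (\<Sum>w\<in>interval r x z. moebius r x w) * H z = (if x = z then t * H x else 0)"
        by (simp del: of_int_sum)
    qed
    also have "\<dots> = t * H x"
      by (simp add: finite_interval interval_endpoints(1) fp x)
    also have "(\<Sum>w\<in>interval r x y. moebius r x w) = (if x = y then 1 else 0)"
      by (rule sum_moebius_interval[OF fp x])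
    finally show ?thesis by (simp del: mult_pCons_left mult_pCons_right)
  qed
  then have "D x = 0"
    by (rule moebius_sum_eq_0_imp_eq_0[OF fp xy])
  then show ?thesis
    by (simp add: D_def t_def H_def del: mult_pCons_left mult_pCons_right)
qed

section \<open>The polynomials \<open>a n\<close> and the recursion with these weights\<close>

definition power_range_sum :: "nat \<Rightarrow> int poly" where
  "power_range_sum n = (\<Sum>i=1..<n. [:0, 1:] ^ i)"

lemma power_range_sum_1: "power_range_sum (Suc 0) = 0"
  by (simp add: power_range_sum_def)

text \<open>This compares the weight of an element in a poset with its weight in the dual
  truncation, where its rank is one less. At \<open>n = 0\<close> it would read
  \<open>0 = t\<close>.\<close>

lemma power_range_sum_Suc:
  assumes "0 < n"
  shows "power_range_sum (Suc n) = [:0, 1:] + [:0, 1:] * power_range_sum n"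
proof -
  have "power_range_sum (Suc n) = [:0, 1:] ^ 1 + (\<Sum>i=1..<n. [:0, 1:] ^ Suc i)"
    using assms unfolding power_range_sum_def
    by (subst sum.atLeast_Suc_lessThan) (simp_all only: sum.shift_bounds_Suc_ivl One_nat_def Suc_less_eq)
  then show ?thesis
    by (simp add: power_range_sum_def sum_distrib_left del: mult_pCons_left)
qed

lemma power_range_sum_mult:
  assumes "0 < n"
  shows "[:-1, 1:] * power_range_sum n = [:0, 1:] ^ n - [:0, 1:]"
  using assms
proof (induction n rule: nat_induct_non_zero)
  case (Suc n)
  have "[:-1, 1:] * power_range_sum (Suc n) =
      [:0, 1:] * ([:-1, 1:] + [:-1, 1:] * power_range_sum n)"
    by (simp only: power_range_sum_Suc[OF Suc.hyps] distrib_left mult.left_commute)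
       (simp add: mult.commute)
  also have "\<dots> = [:0, 1:] ^ Suc n - [:0, 1:]"
    unfolding Suc.IH by (simp add: algebra_simps one_pCons)
  finally show ?case .
qed (simp add: power_range_sum_1)

text \<open>Unrolled, this expresses the Chow polynomial as a sum over chains.\<close>

lemma chow_interval_rec:
  assumes P: "bounded_graded_poset r" and xy: "(x, y) \<in> r"
  shows "chow_interval r x y =
    1 + (\<Sum>z\<in>interval r x y - {x}. power_range_sum (rk r z - rk r x) * chow_interval r z y)"
    (is "?H = 1 + ?S")
proof -
  note fp = bounded_graded_poset_imp_finite[OF P]
  have "(\<Sum>z\<in>interval r x y - {x}. ([:0, 1:] - [:0, 1:] ^ (rk r z - rk r x)) * chow_interval r z y)
      = (\<Sum>z\<in>interval r x y - {x}.
           - ([:-1, 1:] * (power_range_sum (rk r z - rk r x) * chow_interval r z y)))"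
  proof (intro sum.cong refl)
    fix z assume "z \<in> interval r x y - {x}"
    then have "0 < rk r z - rk r x"
      using rk_strict_mono[OF P, of x z] by (auto simp: interval_def)
    from power_range_sum_mult[OF this]
    have "[:0, 1:] - [:0, 1:] ^ (rk r z - rk r x) = - ([:-1, 1:] * power_range_sum (rk r z - rk r x))"
      by simp
    then show "([:0, 1:] - [:0, 1:] ^ (rk r z - rk r x)) * chow_interval r z y =
        - ([:-1, 1:] * (power_range_sum (rk r z - rk r x) * chow_interval r z y))"
      by (simp only: mult_minus_left mult.assoc)
  qed
  also have "\<dots> = - ([:-1, 1:] * ?S)"
    by (simp add: sum_negf sum_distrib_left del: mult_pCons_left)
  \<comment> \<open>The summand \<open>z = x\<close> has exponent zero and so weight
    \<open>t - 1\<close>; every term now carries this factor, which can be cancelled.\<close>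
  finally have "([:0, 1:] - 1) * ?H - [:-1, 1:] * ?S = [:-1, 1:]"
    using sum_chow_interval_ranks[OF fp xy]
    by (simp add: sum.remove[OF finite_interval interval_endpoints(1)] fp xy
        del: mult_pCons_left)
  moreover have "[:0, 1:] - 1 = [:-1, 1::int:]"
    by (simp add: one_pCons)
  ultimately have "[:-1, 1:] * ?H = [:-1, 1:] * (1 + ?S)"
    by (simp add: distrib_left diff_eq_eq del: mult_pCons_left)
  then show ?thesis
    by (simp only: mult_cancel_left) simp
qed

lemma poset_bot_le: "bounded_poset r \<Longrightarrow> x \<in> Field r \<Longrightarrow> (poset_bot r, x) \<in> r"
  using is_least_poset_bot by (auto simp: is_least_def)

lemma le_poset_top: "bounded_poset r \<Longrightarrow> x \<in> Field r \<Longrightarrow> (x, poset_top r) \<in> r"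
  using is_greatest_poset_top by (auto simp: is_greatest_def)

lemma poset_bot_in_Field: "bounded_poset r \<Longrightarrow> poset_bot r \<in> Field r"
  using is_least_poset_bot by (auto simp: is_least_def)

lemma poset_top_in_Field: "bounded_poset r \<Longrightarrow> poset_top r \<in> Field r"
  using is_greatest_poset_top by (auto simp: is_greatest_def)

lemma rk_eq_0_iff:
  assumes P: "bounded_graded_poset r" and x: "x \<in> Field r"
  shows "rk r x = 0 \<longleftrightarrow> x = poset_bot r"
proof
  assume "rk r x = 0"
  then show "x = poset_bot r"
    using rk_strict_mono[OF P poset_bot_le[OF _ x]] P by (auto simp: bounded_graded_poset_def)
next
  assume "x = poset_bot r"
  then show "rk r x = 0"
    using rank_function_rk[OF P] by (simp add: rank_function_def)
qed

lemma rk_mono: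
  assumes "bounded_graded_poset r" "(x, y) \<in> r"
  shows "rk r x \<le> rk r y"
  using rk_strict_mono[OF assms] by (cases "x = y") auto

text \<open>At the least element the interval is the whole poset and rank differences are ranks.
  Atoms drop out because \<open>a 1 = 0\<close>.\<close>

lemma chow_polynomial_rec:
  assumes P: "bounded_graded_poset r"
  shows "chow_polynomial r = 1 + (\<Sum>z | z \<in> Field r \<and> 2 \<le> rk r z.
           power_range_sum (rk r z) * chow_interval r z (poset_top r))"
proof -
  have B: "bounded_poset r" and fp: "finite_poset r"
    using P by (auto simp: bounded_graded_poset_def bounded_poset_def)
  let ?b = "poset_bot r"
  let ?f = "\<lambda>z. power_range_sum (rk r z) * chow_interval r z (poset_top r)"
  have I: "interval r ?b (poset_top r) = Field r"
    using poset_bot_le[OF B] le_poset_top[OF B] by (auto simp: interval_def Field_def)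
  have b0: "rk r ?b = 0"
    using rk_eq_0_iff[OF P poset_bot_in_Field[OF B]] by simp
  have "chow_polynomial r = 1 + sum ?f (Field r - {?b})"
    unfolding chow_polynomial_def
    using chow_interval_rec[OF P poset_bot_le[OF B poset_top_in_Field[OF B]]] by (simp add: I b0)
  also have "sum ?f (Field r - {?b}) = sum ?f {z. z \<in> Field r \<and> 2 \<le> rk r z}"
  proof (rule sum.mono_neutral_right)
    show "finite (Field r - {?b})" using fp by (simp add: finite_poset_def)
    show "\<forall>z\<in>Field r - {?b} - {z. z \<in> Field r \<and> 2 \<le> rk r z}. ?f z = 0"
    proof
      fix z assume z: "z \<in> Field r - {?b} - {z. z \<in> Field r \<and> 2 \<le> rk r z}"
      then have "rk r z = Suc 0" using rk_eq_0_iff[OF P, of z] by auto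
      then show "?f z = 0" by (simp add: power_range_sum_1)
    qed
  qed (use b0 in auto)
  finally show ?thesis .
qed

section \<open>Order, ranks and Chow polynomials of the dual truncation\<close>

lemma Field_Restr_finite_poset:
  assumes "finite_poset r" "A \<subseteq> Field r"
  shows "Field (Restr r A) = A"
proof
  show "A \<subseteq> Field (Restr r A)"
    using assms finite_poset_refl[OF assms(1)] by (auto intro: FieldI1)
qed (auto simp: Field_def)

lemma finite_poset_Restr: "finite_poset r \<Longrightarrow> finite_poset (Restr r A)"
  unfolding finite_poset_def
  by (metis Partial_order_Restr finite_subset inf_le1 mono_Field)

context
  fixes P :: "'a rel"
  assumes P: "bounded_graded_poset P"
begin

private lemma B: "bounded_poset P" and fp: "finite_poset P"
  using P by (auto simp: bounded_graded_poset_def bounded_poset_def)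

lemma Field_dual_truncation: "Field (dual_truncation P) = {x \<in> Field P. rk P x \<noteq> 1}"
  unfolding dual_truncation_def by (rule Field_Restr_finite_poset[OF fp]) auto

lemma dual_truncation_iff:
  "(x, y) \<in> dual_truncation P \<longleftrightarrow> (x, y) \<in> P \<and> rk P x \<noteq> 1 \<and> rk P y \<noteq> 1"
  by (auto simp: dual_truncation_def Field_def)

lemma finite_poset_dual_truncation: "finite_poset (dual_truncation P)"
  unfolding dual_truncation_def by (rule finite_poset_Restr[OF fp])

lemma is_least_dual_truncation: "is_least (dual_truncation P) (poset_bot P)"
  using poset_bot_in_Field[OF B] poset_bot_le[OF B] rk_eq_0_iff[OF P poset_bot_in_Field[OF B]]
  by (auto simp: is_least_def Field_dual_truncation dual_truncation_iff)

text \<open>In rank at most one, every element except the least one is an atom, so the truncation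
  collapses to the least element.\<close>

lemma is_greatest_dual_truncation:
  "is_greatest (dual_truncation P) (if 2 \<le> poset_rank P then poset_top P else poset_bot P)"
proof (cases "2 \<le> poset_rank P")
  case True
  then show ?thesis
    using poset_top_in_Field[OF B] le_poset_top[OF B]
    by (auto simp: is_greatest_def Field_dual_truncation dual_truncation_iff poset_rank_def)
next
  case False
  have "x = poset_bot P" if "x \<in> Field (dual_truncation P)" for x
  proof -
    have "x \<in> Field P" "rk P x \<noteq> 1" using that by (auto simp: Field_dual_truncation)
    moreover have "rk P x \<le> 1"
      using rk_mono[OF P le_poset_top[OF B, of x]] False calculation by (simp add: poset_rank_def)
    ultimately show ?thesis using rk_eq_0_iff[OF P, of x] by linarith
  qed
  then show ?thesis
    using False is_least_dual_truncation by (auto simp: is_greatest_def is_least_def)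
qed

lemma bounded_poset_dual_truncation: "bounded_poset (dual_truncation P)"
  using finite_poset_dual_truncation is_least_dual_truncation is_greatest_dual_truncation
  unfolding bounded_poset_def by blast

lemma poset_bot_dual_truncation: "poset_bot (dual_truncation P) = poset_bot P"
  by (rule poset_bot_eq[OF bounded_poset_dual_truncation is_least_dual_truncation])

lemma poset_top_dual_truncation:
  "poset_top (dual_truncation P) = (if 2 \<le> poset_rank P then poset_top P else poset_bot P)"
  by (rule poset_top_eq[OF bounded_poset_dual_truncation is_greatest_dual_truncation])

text \<open>The truncated subtraction keeps the rank of the least element at zero.\<close>

lemma rank_function_dual_truncation: "rank_function (dual_truncation P) (\<lambda>x. rk P x - 1)"
  unfolding rank_function_def poset_bot_dual_truncation
proof (intro conjI allI impI)
  show "rk P (poset_bot P) - 1 = 0"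
    using rk_eq_0_iff[OF P poset_bot_in_Field[OF B]] by simp
  fix x y assume c: "covers (dual_truncation P) x y"
  then have xy: "(x, y) \<in> P" "x \<noteq> y" "rk P x \<noteq> 1" "rk P y \<noteq> 1"
    by (auto simp: covers_def dual_truncation_iff)
  have max: "z = x \<or> z = y" if "(x, z) \<in> P" "(z, y) \<in> P" "rk P z \<noteq> 1" for z
    using c that xy by (auto simp: covers_def dual_truncation_iff)
  obtain w where w: "(x, w) \<in> P" "covers P w y"
    using ex_lower_cover[OF fp xy(1,2)] by blast
  have rw: "rk P y = Suc (rk P w)"
    using rank_function_rk[OF P] w by (simp add: rank_function_def)
  have "w \<noteq> y" "(w, y) \<in> P" using w by (auto simp: covers_def)
  show "rk P y - 1 = Suc (rk P x - 1)"
  \<comment> \<open>A new cover arises only when the lower cover \<open>w\<close> was a removed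
    atom; then \<open>x\<close> has rank 0 and \<open>y\<close> rank 2. Otherwise
    \<open>w = x\<close>, and \<open>x\<close> has positive rank because \<open>y\<close> is not an
    atom, so both ranks really drop by one.\<close>
  proof (cases "rk P w = 1")
    case True
    then have "rk P x = 0" using rk_mono[OF P w(1)] xy(3) by simp
    then show ?thesis using True rw by simp
  next
    case False
    then have "w = x" using max[OF w(1) \<open>(w, y) \<in> P\<close>] \<open>w \<noteq> y\<close> by simp
    then show ?thesis using rw xy by (cases "rk P x") auto
  qed
qed

lemma bounded_graded_poset_dual_truncation: "bounded_graded_poset (dual_truncation P)"
  using bounded_poset_dual_truncation rank_function_dual_truncation
  unfolding bounded_graded_poset_def by blast

lemma rk_dual_truncation: "x \<in> Field (dual_truncation P) \<Longrightarrow> rk (dual_truncation P) x = rk P x - 1"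
  by (rule rk_eq[OF bounded_poset_dual_truncation rank_function_dual_truncation])

text \<open>Everything above an element of rank at least two has rank at least two, so nothing is
  removed there.\<close>

lemma interval_dual_truncation:
  assumes "2 \<le> rk P x"
  shows "interval (dual_truncation P) x y = interval P x y"
proof -
  have "rk P z \<noteq> 1" if "(x, z) \<in> P" for z
    using rk_mono[OF P that] assms by simp
  then show ?thesis
    using assms finite_poset_trans[OF fp] by (auto simp: interval_def dual_truncation_iff)
qed

text \<open>In the form \<open>chow_interval_rec\<close>, the recursion depends only on the interval
  and on rank differences. Both are preserved, as all ranks involved drop by exactly one.\<close>

lemma chow_interval_dual_truncation:
  assumes "(x, y) \<in> P" "2 \<le> rk P x"
  shows "chow_interval (dual_truncation P) x y = chow_interval P x y"
  using assms
proof (induction "card (interval P x y)" arbitrary: x rule: less_induct)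
  case less
  let ?Q = "dual_truncation P"
  have "rk P y \<noteq> 1" using rk_mono[OF P less.prems(1)] less.prems(2) by simp
  then have xy: "(x, y) \<in> ?Q" using less.prems by (simp add: dual_truncation_iff)
  have "power_range_sum (rk ?Q z - rk ?Q x) * chow_interval ?Q z y =
      power_range_sum (rk P z - rk P x) * chow_interval P z y" if z: "z \<in> interval P x y - {x}" for z
  proof -
    have "(x, z) \<in> P" "(z, y) \<in> P" using z by (auto simp: interval_def)
    then have "2 \<le> rk P z" using rk_mono[OF P, of x z] less.prems(2) by simp
    then have "chow_interval ?Q z y = chow_interval P z y"
      using less.hyps card_interval_less_right[OF fp less.prems(1) z] \<open>(z, y) \<in> P\<close> by blast
    moreover have "x \<in> Field ?Q" "z \<in> Field ?Q"
      using \<open>(x, z) \<in> P\<close> \<open>2 \<le> rk P z\<close> less.prems(2)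
      by (auto simp: Field_dual_truncation intro: FieldI1 FieldI2)
    ultimately show ?thesis
      using less.prems(2) by (simp add: rk_dual_truncation)
  qed
  then show ?case
    unfolding chow_interval_rec[OF bounded_graded_poset_dual_truncation xy]
      chow_interval_rec[OF P less.prems(1)] interval_dual_truncation[OF less.prems(2)]
    by simp
qed

lemma rk_le_poset_rank: "x \<in> Field P \<Longrightarrow> rk P x \<le> poset_rank P"
  unfolding poset_rank_def by (rule rk_mono[OF P le_poset_top[OF B]])

lemma rk_ge_2_dual_truncation:
  "{z. z \<in> Field (dual_truncation P) \<and> 2 \<le> rk (dual_truncation P) z} =
   {z. z \<in> Field P \<and> 3 \<le> rk P z}"
  by (auto simp: rk_dual_truncation) (auto simp: Field_dual_truncation rk_dual_truncation)

text \<open>An element of rank at least two forces \<open>2 \<le> poset_rank P\<close>, so the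
  truncation keeps the greatest element.\<close>

lemma chow_dual_truncation_top:
  assumes "z \<in> Field P" "2 \<le> rk P z"
  shows "chow_interval (dual_truncation P) z (poset_top (dual_truncation P)) =
         chow_interval P z (poset_top P)"
  using chow_interval_dual_truncation[OF le_poset_top[OF B assms(1)] assms(2)]
    rk_le_poset_rank[OF assms(1)] assms(2) by (simp add: poset_top_dual_truncation)

text \<open>The recursion in the truncation runs over ranks at least 3 in \<open>P\<close>. Elements
  of rank 2 become atoms with weight \<open>a 1 = 0\<close>; adding them gives the index set of
  \<open>chow_polynomial_rec\<close> for \<open>P\<close>.\<close>

lemma chow_polynomial_dual_truncation:
  "chow_polynomial (dual_truncation P) = 1 + (\<Sum>z | z \<in> Field P \<and> 2 \<le> rk P z.
     power_range_sum (rk P z - 1) * chow_interval P z (poset_top P))"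
proof -
  let ?Q = "dual_truncation P"
  have "chow_polynomial ?Q = 1 + (\<Sum>z | z \<in> Field P \<and> 3 \<le> rk P z.
           power_range_sum (rk ?Q z) * chow_interval ?Q z (poset_top ?Q))"
    unfolding chow_polynomial_rec[OF bounded_graded_poset_dual_truncation] rk_ge_2_dual_truncation ..
  also have "(\<Sum>z | z \<in> Field P \<and> 3 \<le> rk P z.
           power_range_sum (rk ?Q z) * chow_interval ?Q z (poset_top ?Q)) =
      (\<Sum>z | z \<in> Field P \<and> 3 \<le> rk P z.
           power_range_sum (rk P z - 1) * chow_interval P z (poset_top P))"
    by (intro sum.cong refl)
       (simp add: chow_dual_truncation_top rk_dual_truncation Field_dual_truncation)
  also have "\<dots> = (\<Sum>z | z \<in> Field P \<and> 2 \<le> rk P z.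
           power_range_sum (rk P z - 1) * chow_interval P z (poset_top P))"
  proof (rule sum.mono_neutral_left)
    show "finite {z. z \<in> Field P \<and> 2 \<le> rk P z}"
      using fp by (simp add: finite_poset_def)
    show "\<forall>z\<in>{z. z \<in> Field P \<and> 2 \<le> rk P z} - {z. z \<in> Field P \<and> 3 \<le> rk P z}.
        power_range_sum (rk P z - 1) * chow_interval P z (poset_top P) = 0"
    proof
      fix z assume "z \<in> {z. z \<in> Field P \<and> 2 \<le> rk P z} - {z. z \<in> Field P \<and> 3 \<le> rk P z}"
      then have "rk P z - 1 = Suc 0" by auto
      then show "power_range_sum (rk P z - 1) * chow_interval P z (poset_top P) = 0"
        by (simp add: power_range_sum_1)
    qed
  qed auto
  finally show ?thesis .
qed

text \<open>
  Including the greatest element in the sum, at the cost of the summand \<open>- t\<close>, makes the first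
  identity valid in ranks \<open>0\<close> and \<open>1\<close> too; so it can be applied twice to obtain the second one.
\<close>

lemma chow_polynomial_eq_sum_dual_truncation:
  "chow_polynomial P = 1 - [:0, 1:]
     + [:0, 1:] * (\<Sum>z | z \<in> Field P \<and> 2 \<le> rk P z. chow_interval P z (poset_top P))
     + [:0, 1:] * chow_polynomial (dual_truncation P)"
proof -
  let ?A = "{z. z \<in> Field P \<and> 2 \<le> rk P z}"
  let ?H = "\<lambda>z. chow_interval P z (poset_top P)"
  have "chow_polynomial P = 1 + (\<Sum>z\<in>?A. power_range_sum (rk P z) * ?H z)"
    by (rule chow_polynomial_rec[OF P])
  also have "(\<Sum>z\<in>?A. power_range_sum (rk P z) * ?H z) =
      (\<Sum>z\<in>?A. [:0, 1:] * ?H z + [:0, 1:] * (power_range_sum (rk P z - 1) * ?H z))"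
  proof (intro sum.cong refl)
    fix z assume "z \<in> ?A"
    then have "power_range_sum (rk P z) = [:0, 1:] + [:0, 1:] * power_range_sum (rk P z - 1)"
      using power_range_sum_Suc[of "rk P z - 1"] by simp
    then show "power_range_sum (rk P z) * ?H z =
        [:0, 1:] * ?H z + [:0, 1:] * (power_range_sum (rk P z - 1) * ?H z)"
      by (simp only: distrib_right mult.assoc)
  qed
  also have "\<dots> = [:0, 1:] * sum ?H ?A
      + [:0, 1:] * (\<Sum>z\<in>?A. power_range_sum (rk P z - 1) * ?H z)"
    by (simp only: sum.distrib sum_distrib_left)
  also have "(\<Sum>z\<in>?A. power_range_sum (rk P z - 1) * ?H z) =
      chow_polynomial (dual_truncation P) - 1"
    by (simp add: chow_polynomial_dual_truncation)
  finally show ?thesis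
    by (simp only: right_diff_distrib mult_1_right)
qed

end

text \<open>In rank 0 or 1 the first sum is empty and both Chow polynomials are 1, so the first
  identity would read \<open>1 = 1 + t\<close>; this explains its guard.\<close>

theorem theorem4p1:
  fixes P :: "'a rel"
  assumes "bounded_graded_poset P"
  shows "(2 \<le> poset_rank P \<longrightarrow>
           chow_polynomial P =
             1 + [:0, 1:] * (\<Sum>x | x \<in> Field P \<and> 2 \<le> rk P x \<and> rk P x \<le> poset_rank P - 1.
                               chow_interval P x (poset_top P))
               + [:0, 1:] * chow_polynomial (dual_truncation P)) \<and>
         chow_polynomial P =
           ([:0, 1:] + 1) * chow_polynomial (dual_truncation P)
             - [:0, 1:] * chow_polynomial (dual_truncation (dual_truncation P))
             + [:0, 1:] * (\<Sum>x | x \<in> Field P \<and> rk P x = 2. chow_interval P x (poset_top P))"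
proof
  have B: "bounded_poset P" and fp: "finite_poset P" and fin: "finite (Field P)"
    using assms by (auto simp: bounded_graded_poset_def bounded_poset_def finite_poset_def)
  let ?Q = "dual_truncation P"
  let ?H = "\<lambda>z. chow_interval P z (poset_top P)"
  define t :: "int poly" where "t = [:0, 1:]"
  note main = chow_polynomial_eq_sum_dual_truncation[folded t_def]
  show "2 \<le> poset_rank P \<longrightarrow>
      chow_polynomial P =
        1 + [:0, 1:] * (\<Sum>x | x \<in> Field P \<and> 2 \<le> rk P x \<and> rk P x \<le> poset_rank P - 1. ?H x)
          + [:0, 1:] * chow_polynomial ?Q"
  proof
    assume n: "2 \<le> poset_rank P"
    let ?A = "{x. x \<in> Field P \<and> 2 \<le> rk P x \<and> rk P x \<le> poset_rank P - 1}"
    have "x = poset_top P" if "x \<in> Field P" "\<not> rk P x \<le> poset_rank P - 1" for x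
      using rk_strict_mono[OF assms le_poset_top[OF B that(1)]] that(2)
      by (cases "x = poset_top P") (auto simp: poset_rank_def)
    \<comment> \<open>Splitting off the greatest element, whose Chow polynomial is 1, produces a
      summand \<open>t\<close> that cancels the \<open>- t\<close> in \<open>main\<close>.\<close>
    then have "{x. x \<in> Field P \<and> 2 \<le> rk P x} = insert (poset_top P) ?A"
      using n poset_top_in_Field[OF B] by (auto simp: poset_rank_def)
    moreover have "poset_top P \<notin> ?A"
      using n by (auto simp: poset_rank_def)
    moreover have "?H (poset_top P) = 1"
      using fp finite_poset_refl[OF fp poset_top_in_Field[OF B]]
      by (simp add: chow_interval.simps[of P "poset_top P"])
    ultimately have "(\<Sum>x | x \<in> Field P \<and> 2 \<le> rk P x. ?H x) = 1 + sum ?H ?A"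
      using fin by simp
    then show "chow_polynomial P = 1 + [:0, 1:] * sum ?H ?A + [:0, 1:] * chow_polynomial ?Q"
      unfolding main[OF assms] t_def[symmetric] by (simp add: algebra_simps)
  qed
  have "(\<Sum>x | x \<in> Field ?Q \<and> 2 \<le> rk ?Q x. chow_interval ?Q x (poset_top ?Q)) =
      (\<Sum>x | x \<in> Field P \<and> 3 \<le> rk P x. ?H x)"
    unfolding rk_ge_2_dual_truncation[OF assms]
    by (intro sum.cong refl) (simp add: chow_dual_truncation_top[OF assms])
  then have Q: "chow_polynomial ?Q =
      1 - t + t * (\<Sum>x | x \<in> Field P \<and> 3 \<le> rk P x. ?H x) + t * chow_polynomial (dual_truncation ?Q)"
    using main[OF bounded_graded_poset_dual_truncation[OF assms]] by simp
  have "{x. x \<in> Field P \<and> 2 \<le> rk P x} =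
      {x. x \<in> Field P \<and> rk P x = 2} \<union> {x. x \<in> Field P \<and> 3 \<le> rk P x}"
    by auto
  then have split: "(\<Sum>x | x \<in> Field P \<and> 2 \<le> rk P x. ?H x) =
      (\<Sum>x | x \<in> Field P \<and> rk P x = 2. ?H x) + (\<Sum>x | x \<in> Field P \<and> 3 \<le> rk P x. ?H x)"
    using fin by (simp add: sum.union_disjoint disjoint_iff)
  \<comment> \<open>The second identity is \<open>main\<close> for \<open>P\<close> minus
    \<open>main\<close> for \<open>?Q\<close>: solving the latter for \<open>1 - t\<close> and
    substituting cancels the sums over ranks at least 3.\<close>
  have "1 - t = chow_polynomial ?Q - t * (\<Sum>x | x \<in> Field P \<and> 3 \<le> rk P x. ?H x)
      - t * chow_polynomial (dual_truncation ?Q)"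
    by (simp add: Q)
  then show "chow_polynomial P =
      ([:0, 1:] + 1) * chow_polynomial ?Q - [:0, 1:] * chow_polynomial (dual_truncation ?Q)
        + [:0, 1:] * (\<Sum>x | x \<in> Field P \<and> rk P x = 2. ?H x)"
    unfolding t_def[symmetric] main[OF assms] split by (simp add: algebra_simps)
qed

end
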